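(* Let $G=(V,E,\mathbf w)$ be a weighted undirected graph with $n$ vertices whose Laplacian $L_G$ has eigenvalues $0=\lambda_1=\dots=\lambda_k<\lambda_{k+1}\le\dots\le\lambda_n$ (so $\lambda_{k+1}$ is the first nonzero eigenvalue; $G$ has $k$ clusters). Let $L_{H_i}$, $R_i$ be the iterates of the UGA for graph sparsification described in the context. If $\|R_i\|_2/\lambda_{k+1}<1$, then $$\Big(1-\frac{\|R_i\|_2}{\lambda_{k+1}}\Big)L_G\preceq L_{H_i}\preceq\Big(1+\frac{\|R_i\|_2}{\lambda_{k+1}}\Big)L_G.$$
   Context: $\mathbf e_u\in\mathbb R^n$ are standard basis vectors, $\phi_{(u,v)}=(\mathbf e_u-\mathbf e_v)(\mathbf e_u-\mathbf e_v)^\top$, $L_G=\sum_{(u,v)\in E}w_{(u,v)}\phi_{(u,v)}$ with $w_{(u,v)}>0$; $\langle X,Y\rangle=\mathrm{tr}(X^\top Y)$, $\|\cdot\|_F$ the Frobenius norm, $\|\cdot\|_2$ the operator norm, and $X\preceq Y$ means $Y-X$ is positive semidefinite. The UGA for graph sparsification: $R_0=L_G$, $L_{H_0}=0$; for $i=1,2,\dots$: choose $(u_i,v_i)\in E$ maximizing $|\langle\phi_{(u,v)},R_{i-1}\rangle|$ over $(u,v)\in E$; compute $(\alpha_1^i,\alpha_2^i)\in\arg\min_{(\alpha_1,\alpha_2)\in\mathbb R^2}\|L_G-\alpha_1L_{H_{i-1}}-\alpha_2\phi_{(u_i,v_i)}\|_F^2$; set $L_{H_i}=\alpha_1^iL_{H_{i-1}}+\alpha_2^i\phi_{(u_i,v_i)}$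 and $R_i=L_G-L_{H_i}$. *)

theory Defs
  imports
    "HOL-Analysis.Analysis"
    "HOL-Library.Uprod"
    "HOL-Computational_Algebra.Polynomial"
begin

subsection \<open>Matrices\<close>

definition frob_inner :: "real^'n^'n \<Rightarrow> real^'n^'n \<Rightarrow> real" where
  "frob_inner X Y = trace (transpose X ** Y)"

definition frob_norm :: "real^'n^'n \<Rightarrow> real" where
  "frob_norm X = sqrt (frob_inner X X)"

definition op_norm :: "real^'n^'n \<Rightarrow> real" where
  "op_norm X = onorm (\<lambda>x. X *v x)"

definition psd :: "real^'n^'n \<Rightarrow> bool" where
  "psd X \<longleftrightarrow> transpose X = X \<and> (\<forall>x. 0 \<le> x \<bullet> (X *v x))"

definition loewner_le :: "real^'n^'n \<Rightarrow> real^'n^'n \<Rightarrow> bool"  (infix "\<preceq>" 50) where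
  "X \<preceq> Y \<longleftrightarrow> psd (Y - X)"

definition charpoly :: "real^'n^'n \<Rightarrow> real poly" where
  "charpoly X = det (mat [:0, 1:] - (\<chi> i j. [:X $ i $ j:]))"

text \<open>The values \<open>lam 1 \<le> \<dots> \<le> lam n\<close> are the eigenvalues of the \<open>n \<times> n\<close> matrix \<open>X\<close>,
  repeated according to multiplicity; \<open>lam\<close> is unconstrained outside \<open>{1..n}\<close>.\<close>

definition ordered_eigenvalues :: "real^'n^'n \<Rightarrow> (nat \<Rightarrow> real) \<Rightarrow> bool" where
  "ordered_eigenvalues X lam \<longleftrightarrow>
     charpoly X = (\<Prod>i = 1..CARD('n). [:- lam i, 1:]) \<and> mono_on {1..CARD('n)} lam"

subsection \<open>Graph Laplacians\<close>

text \<open>A weighted undirected graph has the finite type \<open>'n\<close> as its vertex set, a set \<open>E\<close> of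
  unordered pairs as edges and a weight function \<open>w\<close>, of which only the values on \<open>E\<close> matter.
  Loops are not excluded; their edge matrix is zero.\<close>

definition edge_matrix :: "'n \<Rightarrow> 'n \<Rightarrow> real^'n^'n" where
  "edge_matrix u v =
     (let b = axis u 1 - axis v 1 in (columnvector b :: real^1^'n) ** (rowvector b :: real^'n^1))"

lemma edge_matrix_commute: "edge_matrix u v = edge_matrix v u"
  by (simp add: edge_matrix_def Let_def matrix_matrix_mult_def columnvector_def rowvector_def
      vec_eq_iff algebra_simps)

lift_definition phi :: "'n uprod \<Rightarrow> real^'n^'n" is "\<lambda>(u, v). edge_matrix u v"
  using edge_matrix_commute by auto

lemma phi_Upair: "phi (Upair u v) = edge_matrix u v"
  by transfer simp

definition laplacian :: "'n uprod set \<Rightarrow> ('n uprod \<Rightarrow> real) \<Rightarrow> real^'n^'n" where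
  "laplacian E w = (\<Sum>e\<in>E. w e *\<^sub>R phi e)"

subsection \<open>The UGA for graph sparsification\<close>

text \<open>\<open>uga E w LH R\<close> says that \<open>LH\<close> and \<open>R\<close> are the iterates \<open>L\<^bsub>H\<^sub>i\<^esub>\<close> and \<open>R\<^sub>i\<close> of
  some run of the algorithm: every choice of a maximising edge \<open>e\<close> and of minimising
  coefficients \<open>a\<^sub>1, a\<^sub>2\<close> is allowed, so ties may be broken arbitrarily.\<close>

definition uga ::
  "'n uprod set \<Rightarrow> ('n uprod \<Rightarrow> real) \<Rightarrow> (nat \<Rightarrow> real^'n^'n) \<Rightarrow> (nat \<Rightarrow> real^'n^'n) \<Rightarrow> bool" where
  "uga E w LH R \<longleftrightarrow>
     R 0 = laplacian E w \<and> LH 0 = 0 \<and>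
     (\<forall>i\<ge>1. \<exists>e a\<^sub>1 a\<^sub>2.
        is_arg_max (\<lambda>e. \<bar>frob_inner (phi e) (R (i - 1))\<bar>) (\<lambda>e. e \<in> E) e \<and>
        is_arg_min
          (\<lambda>(b\<^sub>1, b\<^sub>2). (frob_norm (laplacian E w - b\<^sub>1 *\<^sub>R LH (i - 1) - b\<^sub>2 *\<^sub>R phi e))\<^sup>2)
          (\<lambda>_. True) (a\<^sub>1, a\<^sub>2) \<and>
        LH i = a\<^sub>1 *\<^sub>R LH (i - 1) + a\<^sub>2 *\<^sub>R phi e \<and>
        R i = laplacian E w - LH i)"

end

theory Submission
  imports Defs
begin

text \<open>Every \<open>L\<^bsub>H\<^sub>i\<^esub>\<close> is a combination of edge matrices of \<open>G\<close>, each of which kills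
  \<open>ker L\<^bsub>G\<^esub>\<close> because the weights are positive. So \<open>R\<^sub>i\<close> is a symmetric matrix vanishing on
  \<open>ker L\<^bsub>G\<^esub>\<close>, and its quadratic form only sees the component of a vector orthogonal to that
  kernel. There the Rayleigh quotient of \<open>L\<^bsub>G\<^esub>\<close> attains its minimum at an eigenvector with
  positive eigenvalue, hence is at least \<open>\<lambda>\<^bsub>k+1\<^esub>\<close>, while that of \<open>R\<^sub>i\<close> is at most
  \<open>\<parallel>R\<^sub>i\<parallel>\<^sub>2\<close> in absolute value.\<close>

section \<open>Quadratic forms of matrices\<close>

lemma inner_matrix_symmetric:
  fixes A :: "real^'n^'n"
  assumes "transpose A = A"
  shows "x \<bullet> (A *v y) = (A *v x) \<bullet> y"
  by (metis assms dot_lmul_matrix transpose_matrix_vector)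

lemma abs_inner_matrix_le_op_norm:
  fixes A :: "real^'n^'n"
  shows "\<bar>x \<bullet> (A *v x)\<bar> \<le> op_norm A * (x \<bullet> x)"
proof -
  have "\<bar>x \<bullet> (A *v x)\<bar> \<le> norm x * norm (A *v x)"
    by (rule Cauchy_Schwarz_ineq2)
  also have "\<dots> \<le> norm x * (op_norm A * norm x)"
    unfolding op_norm_def by (intro mult_left_mono onorm matrix_vector_mul_bounded_linear norm_ge_zero)
  finally show ?thesis
    by (simp add: power2_norm_eq_inner[symmetric] power2_eq_square mult_ac)
qed

section \<open>Characteristic polynomial and eigenvalues\<close>

text \<open>Evaluation at \<open>t\<close> is a ring homomorphism, so it passes through the Leibniz
  expansion to the entries.\<close>

lemma poly_charpoly: "poly (charpoly X) t = det (mat t - X)"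
proof -
  have entry: "poly ((mat [:0, 1:] - (\<chi> i j. [:X $ i $ j:])) $ i $ j) t = (mat t - X) $ i $ j" for i j
    by (simp add: mat_def)
  show ?thesis
    unfolding charpoly_def det_def
    by (simp add: poly_sum poly_prod entry del: vector_minus_component)
qed

lemma charpoly_root:
  assumes "X *v z = t *\<^sub>R z" and "z \<noteq> 0"
  shows "poly (charpoly X) t = 0"
proof -
  have "mat t *v z = t *\<^sub>R z"
    by (simp add: mat_def matrix_vector_mult_def vec_eq_iff if_distrib[where f="\<lambda>x. x * _"] cong: if_cong)
  then have "(mat t - X) *v z = 0"
    using assms by (simp add: matrix_vector_mult_diff_rdistrib)
  then have "\<not> invertible (mat t - X)"
    using assms(2) by (metis invertible_left_inverse matrix_left_invertible_ker)
  then show ?thesis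
    by (simp add: poly_charpoly invertible_det_nz)
qed

text \<open>The list \<open>lam\<close> is specified only by factoring the characteristic
  polynomial. This places an eigenvalue found by other means in the list: a product vanishing at
  \<open>t\<close> has a vanishing factor.\<close>

lemma eigenvalue_in_ordered_eigenvalues:
  fixes X :: "real^'n^'n"
  assumes "ordered_eigenvalues X lam" and "X *v z = t *\<^sub>R z" and "z \<noteq> 0"
  obtains j where "j \<in> {1..CARD('n)}" and "lam j = t"
proof -
  have "poly (\<Prod>i = 1..CARD('n). [:- lam i, 1:]) t = 0"
    using charpoly_root assms by (metis ordered_eigenvalues_def)
  then show ?thesis
    using that by (auto simp: poly_prod)
qed

section \<open>Rayleigh quotients and the spectral gap\<close>

lemma nonneg_quadratic_imp_linear_coeff_zero:
  fixes b c :: real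
  assumes "\<And>t. 0 \<le> 2 * t * b + t\<^sup>2 * c"
  shows "b = 0"
proof (rule ccontr)
  assume "b \<noteq> 0"
  \<comment> \<open>At \<open>t = - b / d\<close> the linear term beats the quadratic one as soon as
    \<open>c < 2 * d\<close>.\<close>
  define d where "d = \<bar>c\<bar> + 1"
  have d: "d > 0" "c < 2 * d" by (auto simp: d_def)
  have "2 * (- b / d) * b + (- b / d)\<^sup>2 * c = b\<^sup>2 / d\<^sup>2 * (c - 2 * d)"
    using d(1) by (simp add: field_simps power2_eq_square)
  also have "\<dots> < 0"
    using \<open>b \<noteq> 0\<close> d by (intro mult_pos_neg) auto
  finally show False using assms[of "- b / d"] by linarith
qed

text \<open>A minimiser of the form on the compact unit sphere of \<open>S\<close> is an
  eigenvector. Invariance keeps the residual \<open>r\<close> inside \<open>S\<close>, so it is an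
  admissible direction of variation.\<close>

lemma symmetric_matrix_min_eigenvector:
  fixes A :: "real^'n^'n"
  assumes sym: "transpose A = A" and S: "subspace S"
    and inv: "\<And>x. x \<in> S \<Longrightarrow> A *v x \<in> S" and nontriv: "x0 \<in> S" "x0 \<noteq> 0"
  obtains z t where "z \<in> S" "z \<noteq> 0" "A *v z = t *\<^sub>R z"
    and "\<And>x. x \<in> S \<Longrightarrow> t * (x \<bullet> x) \<le> x \<bullet> (A *v x)"
proof -
  let ?C = "sphere 0 1 \<inter> S"
  have "compact ?C"
    by (intro compact_Int_closed compact_sphere closed_subspace S)
  moreover have "x0 /\<^sub>R norm x0 \<in> ?C"
    using nontriv S by (simp add: subspace_scale)
  moreover have "continuous_on ?C (\<lambda>x. x \<bullet> (A *v x))"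
    by (intro continuous_intros matrix_vector_mult_linear_continuous_on)
  ultimately obtain z where z: "z \<in> ?C" and min: "\<And>x. x \<in> ?C \<Longrightarrow> z \<bullet> (A *v z) \<le> x \<bullet> (A *v x)"
    using continuous_attains_inf[of ?C "\<lambda>x. x \<bullet> (A *v x)"] by blast
  define t where "t = z \<bullet> (A *v z)"
  have zz: "z \<bullet> z = 1" and zS: "z \<in> S"
    using z by (auto simp: dot_square_norm)
  have bound: "t * (x \<bullet> x) \<le> x \<bullet> (A *v x)" if "x \<in> S" for x
  proof (cases "x = 0")
    case False
    have "x /\<^sub>R norm x \<in> ?C"
      using False S that by (simp add: subspace_scale)
    from min[OF this] have "t \<le> (x \<bullet> (A *v x)) / (norm x)\<^sup>2"
      by (simp add: t_def matrix_vector_mult_scaleR power2_eq_square divide_inverse mult_ac)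
    then show ?thesis
      using False by (simp add: field_simps power2_norm_eq_inner)
  qed simp
  define r where "r = A *v z - t *\<^sub>R z"
  have rS: "r \<in> S"
    unfolding r_def using zS S inv by (simp add: subspace_diff subspace_scale)
  \<comment> \<open>First-order optimality at \<open>z\<close> in the direction of the residual \<open>r\<close> itself.\<close>
  have "0 \<le> 2 * s * (r \<bullet> r) + s\<^sup>2 * (r \<bullet> (A *v r) - t * (r \<bullet> r))" for s
  proof -
    have "z + s *\<^sub>R r \<in> S"
      using zS rS S by (simp add: subspace_add subspace_scale)
    from bound[OF this] have "0 \<le> (z + s *\<^sub>R r) \<bullet> (A *v (z + s *\<^sub>R r)) - t * ((z + s *\<^sub>R r) \<bullet> (z + s *\<^sub>R r))"
      by simp
    \<comment> \<open>The constant term vanishes because \<open>z\<close> is a unit vector and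
      \<open>t\<close> is its form value; symmetry merges the two cross terms.\<close>
    also have "\<dots> = 2 * s * (r \<bullet> (A *v z) - t * (r \<bullet> z)) + s\<^sup>2 * (r \<bullet> (A *v r) - t * (r \<bullet> r))"
      using inner_matrix_symmetric[OF sym, of z r] zz
      by (simp add: t_def matrix_vector_right_distrib matrix_vector_mult_scaleR inner_add_left
          inner_add_right inner_commute algebra_simps power2_eq_square)
    also have "r \<bullet> (A *v z) - t * (r \<bullet> z) = r \<bullet> r"
      by (simp add: r_def inner_diff_right)
    finally show ?thesis .
  qed
  then have "r \<bullet> r = 0"
    by (rule nonneg_quadratic_imp_linear_coeff_zero)
  then have "A *v z = t *\<^sub>R z"
    by (simp add: r_def)
  moreover have "z \<noteq> 0" using zz by auto
  ultimately show ?thesis using that zS bound by blast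
qed

lemma psd_spectral_gap:
  fixes A :: "real^'n^'n"
  assumes A: "psd A"
    and gap: "\<And>z t. \<lbrakk>A *v z = t *\<^sub>R z; z \<noteq> 0; 0 < t\<rbrakk> \<Longrightarrow> l \<le> t"
    and orth: "\<And>y. A *v y = 0 \<Longrightarrow> orthogonal x y"
  shows "l * (x \<bullet> x) \<le> x \<bullet> (A *v x)"
proof (cases "x = 0")
  case False
  have sym: "transpose A = A" and nonneg: "\<And>x. 0 \<le> x \<bullet> (A *v x)"
    using A by (auto simp: psd_def)
  define S where "S = {x. \<forall>y. A *v y = 0 \<longrightarrow> orthogonal x y}"
  have "subspace S"
    by (auto simp: S_def subspace_def orthogonal_clauses)
  \<comment> \<open>The range of a symmetric matrix is orthogonal to its kernel, so \<open>S\<close>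
    is invariant.\<close>
  moreover have "A *v y \<in> S" for y
    using inner_matrix_symmetric[OF sym] by (simp add: S_def orthogonal_def) (metis inner_zero_right)
  moreover have "x \<in> S"
    using orth by (simp add: S_def)
  ultimately obtain z t where z: "z \<in> S" "z \<noteq> 0" "A *v z = t *\<^sub>R z"
    and bound: "\<And>x. x \<in> S \<Longrightarrow> t * (x \<bullet> x) \<le> x \<bullet> (A *v x)"
    using symmetric_matrix_min_eigenvector[OF sym, of S x] False by metis
  have "0 \<le> t * (z \<bullet> z)"
    using nonneg[of z] z(3) by simp
  then have "0 \<le> t"
    using z(2) by (meson inner_gt_zero_iff not_le mult_neg_pos)
  \<comment> \<open>If \<open>t = 0\<close>, then \<open>z\<close> would lie both in the kernel and
    in its complement, hence be orthogonal to itself.\<close>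
  moreover have "t \<noteq> 0"
    using z by (auto simp: S_def orthogonal_def)
  ultimately have "l \<le> t"
    using gap z by simp
  then have "l * (x \<bullet> x) \<le> t * (x \<bullet> x)"
    by (intro mult_right_mono) auto
  with bound[OF \<open>x \<in> S\<close>] show ?thesis by linarith
qed simp

lemma abs_inner_matrix_le_of_ker_subset:
  fixes A B :: "real^'n^'n"
  assumes A: "psd A" and B: "transpose B = B"
    and ker: "\<And>y. A *v y = 0 \<Longrightarrow> B *v y = 0" and l: "0 < l"
    and gap: "\<And>z t. \<lbrakk>A *v z = t *\<^sub>R z; z \<noteq> 0; 0 < t\<rbrakk> \<Longrightarrow> l \<le> t"
  shows "\<bar>x \<bullet> (B *v x)\<bar> \<le> op_norm B / l * (x \<bullet> (A *v x))"
proof -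
  let ?K = "{y. A *v y = 0}"
  have K: "subspace ?K"
    by (simp add: subspace_def matrix_vector_right_distrib matrix_vector_mult_scaleR)
  obtain y z where y: "y \<in> span ?K" and z: "\<And>v. v \<in> span ?K \<Longrightarrow> orthogonal z v" and x: "x = y + z"
    using orthogonal_subspace_decomp_exists[of ?K x] by metis
  \<comment> \<open>Symmetry moves \<open>M\<close> onto \<open>y\<close>, which kills the remaining
    cross term. Used for both \<open>A\<close> and \<open>B\<close>.\<close>
  have form: "x \<bullet> (M *v x) = z \<bullet> (M *v z)" if "transpose M = M" "M *v y = 0" for M :: "real^'n^'n"
    using that inner_matrix_symmetric[OF that(1), of y z]
    by (simp add: x matrix_vector_right_distrib inner_add_left)
  have y0: "A *v y = 0"
    using y K by (simp add: span_eq_iff[THEN iffD2])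
  have "l * (z \<bullet> z) \<le> z \<bullet> (A *v z)"
    using psd_spectral_gap[OF A gap] z by (simp add: span_base)
  moreover have "0 \<le> op_norm B"
    unfolding op_norm_def by (intro onorm_pos_le matrix_vector_mul_bounded_linear)
  ultimately have "op_norm B / l * (l * (z \<bullet> z)) \<le> op_norm B / l * (z \<bullet> (A *v z))"
    using l by (intro mult_left_mono) auto
  moreover have "op_norm B / l * (l * (z \<bullet> z)) = op_norm B * (z \<bullet> z)"
    using l by simp
  ultimately have "\<bar>z \<bullet> (B *v z)\<bar> \<le> op_norm B / l * (z \<bullet> (A *v z))"
    using abs_inner_matrix_le_op_norm[of z B] by linarith
  moreover have "x \<bullet> (A *v x) = z \<bullet> (A *v z)" "x \<bullet> (B *v x) = z \<bullet> (B *v z)"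
    using A B y0 ker form by (auto simp: psd_def)
  ultimately show ?thesis by simp
qed

section \<open>Edge matrices and the kernel of the Laplacian\<close>

lemma transpose_add: "transpose (A + B) = transpose A + transpose B"
  by (simp add: transpose_def vec_eq_iff)

lemma transpose_diff:
  fixes A B :: "'a::ab_group_add^'n^'m"
  shows "transpose (A - B) = transpose A - transpose B"
  by (simp add: transpose_def vec_eq_iff)

lemma transpose_sum: "transpose (\<Sum>i\<in>I. A i) = (\<Sum>i\<in>I. transpose (A i))"
  by (simp add: transpose_def vec_eq_iff)

lemma sum_matrix_vector_mult:
  fixes A :: "'i \<Rightarrow> real^'n^'m"
  shows "(\<Sum>i\<in>I. A i) *v x = (\<Sum>i\<in>I. A i *v x)"
  by (induction I rule: infinite_finite_induct) (simp_all add: matrix_vector_mult_add_rdistrib)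

lemma edge_matrix_mult_vec: "edge_matrix u v *v x = (x $ u - x $ v) *\<^sub>R (axis u 1 - axis v 1)"
proof -
  let ?b = "axis u 1 - axis v 1 :: real^'a"
  have "(edge_matrix u v *v x) $ i = (?b \<bullet> x) * ?b $ i" for i
    by (simp add: edge_matrix_def Let_def matrix_matrix_mult_def matrix_vector_mult_def
        columnvector_def rowvector_def inner_vec_def sum_distrib_left sum_distrib_right mult_ac)
  then show ?thesis
    by (simp add: vec_eq_iff inner_diff_left inner_axis')
qed

lemma transpose_phi [simp]: "transpose (phi e) = phi e"
  by (cases e) (simp add: phi_Upair edge_matrix_def Let_def matrix_matrix_mult_def
      columnvector_def rowvector_def transpose_def vec_eq_iff mult_ac)

lemma inner_phi_nonneg: "0 \<le> x \<bullet> (phi e *v x)"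
  by (cases e) (simp add: phi_Upair edge_matrix_mult_vec inner_diff_right inner_axis)

text \<open>On an edge \<open>Upair u v\<close> the form is \<open>(x $ u - x $ v)\<^sup>2\<close>,
  the square of the coefficient of the image vector.\<close>

lemma phi_mult_vec_eq_0: "phi e *v x = 0" if "x \<bullet> (phi e *v x) = 0"
  using that by (cases e) (simp add: phi_Upair edge_matrix_mult_vec inner_diff_right inner_axis)

lemma inner_laplacian: "x \<bullet> (laplacian E w *v x) = (\<Sum>e\<in>E. w e * (x \<bullet> (phi e *v x)))"
  by (simp add: laplacian_def sum_matrix_vector_mult scaleR_matrix_vector_assoc[symmetric] inner_sum_right)

lemma psd_laplacian:
  assumes "\<And>e. e \<in> E \<Longrightarrow> 0 < w e"
  shows "psd (laplacian E w)"
  unfolding psd_def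
proof
  show "transpose (laplacian E w) = laplacian E w"
    by (simp add: laplacian_def transpose_sum transpose_scalar)
  show "\<forall>x. 0 \<le> x \<bullet> (laplacian E w *v x)"
    unfolding inner_laplacian
    by (intro allI sum_nonneg mult_nonneg_nonneg inner_phi_nonneg less_imp_le assms)
qed

text \<open>On a kernel vector, a sum of nonnegative terms is zero, so every term is; positivity of
  the weights then isolates each edge form.\<close>

lemma phi_mult_vec_eq_0_of_laplacian:
  fixes E :: "'n::finite uprod set"
  assumes w: "\<And>e. e \<in> E \<Longrightarrow> 0 < w e" and x: "laplacian E w *v x = 0" and e: "e \<in> E"
  shows "phi e *v x = 0"
proof -
  have fin: "finite E"
    by (rule finite_subset[OF subset_UNIV]) simp
  have sum0: "(\<Sum>e\<in>E. w e * (x \<bullet> (phi e *v x))) = 0"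
    unfolding inner_laplacian[symmetric] x by simp
  have nonneg: "0 \<le> w e * (x \<bullet> (phi e *v x))" if "e \<in> E" for e
    by (rule mult_nonneg_nonneg[OF less_imp_le[OF w[OF that]] inner_phi_nonneg])
  have "w e * (x \<bullet> (phi e *v x)) = 0"
    using sum_nonneg_0[OF fin nonneg sum0 e] .
  then have "x \<bullet> (phi e *v x) = 0"
    using w[OF e] by simp
  then show ?thesis
    by (rule phi_mult_vec_eq_0)
qed

section \<open>Iterates of the UGA\<close>

lemma uga_residual:
  assumes "uga E w LH R"
  shows "R i = laplacian E w - LH i"
  using assms by (cases i) (auto simp: uga_def Suc_le_eq)

text \<open>Each update combines the previous iterate with one edge matrix of the graph. Symmetry
  and vanishing on the kernel of the Laplacian both pass to the span.\<close>

lemma uga_iterate_in_span: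
  assumes "uga E w LH R"
  shows "LH i \<in> span (phi ` E)"
proof (induction i)
  case 0
  then show ?case using assms by (simp add: uga_def span_zero)
next
  case (Suc i)
  have "Suc i \<ge> 1" by simp
  then obtain e a b where "e \<in> E" "LH (Suc i) = a *\<^sub>R LH i + b *\<^sub>R phi e"
    using assms unfolding uga_def is_arg_max_def by (metis diff_Suc_1)
  with Suc show ?case
    by (simp add: span_add span_scale span_base)
qed

lemma transpose_span_phi:
  assumes "M \<in> span (phi ` E)"
  shows "transpose M = M"
  using assms
proof (induction rule: span_induct_alt)
  case base
  show ?case by (simp add: transpose_def vec_eq_iff)
next
  case (step c M N)
  then show ?case by (auto simp: transpose_add transpose_scalar)
qed

lemma span_phi_mult_vec_eq_0:
  assumes "M \<in> span (phi ` E)" and "\<And>e. e \<in> E \<Longrightarrow> phi e *v x = 0"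
  shows "M *v x = 0"
  using assms(1)
  by (induction rule: span_induct_alt)
     (auto simp: assms(2) matrix_vector_mult_add_rdistrib scaleR_matrix_vector_assoc[symmetric])

theorem theorem3p10:
  fixes E :: "'n::finite uprod set" and w :: "'n uprod \<Rightarrow> real"
    and lam :: "nat \<Rightarrow> real" and k i :: nat
    and LH R :: "nat \<Rightarrow> real^'n^'n"
  assumes "\<And>e. e \<in> E \<Longrightarrow> w e > 0"
    and "ordered_eigenvalues (laplacian E w) lam"
    and "1 \<le> k" and "k < CARD('n)"
    and "\<And>j. 1 \<le> j \<Longrightarrow> j \<le> k \<Longrightarrow> lam j = 0"
    and "0 < lam (k + 1)"
    and "uga E w LH R"
    and "op_norm (R i) / lam (k + 1) < 1"
  shows "(1 - op_norm (R i) / lam (k + 1)) *\<^sub>R laplacian E w \<preceq> LH i \<and>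
         LH i \<preceq> (1 + op_norm (R i) / lam (k + 1)) *\<^sub>R laplacian E w"
proof -
  let ?L = "laplacian E w" and ?l = "lam (k + 1)"
  let ?c = "op_norm (R i) / ?l"
  have L: "psd ?L"
    using assms(1) by (rule psd_laplacian)
  have LH: "LH i \<in> span (phi ` E)"
    using assms(7) by (rule uga_iterate_in_span)
  have Ri: "R i = ?L - LH i"
    using assms(7) by (rule uga_residual)
  have symL: "transpose ?L = ?L"
    using L by (simp add: psd_def)
  have symR: "transpose (R i) = R i"
    by (simp add: Ri transpose_diff symL transpose_span_phi[OF LH])
  have ker: "R i *v y = 0" if "?L *v y = 0" for y
  proof -
    have "LH i *v y = 0"
      using LH phi_mult_vec_eq_0_of_laplacian[OF assms(1) that] by (rule span_phi_mult_vec_eq_0)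
    with that show ?thesis
      by (simp add: Ri matrix_vector_mult_diff_rdistrib)
  qed
  have gap: "?l \<le> t" if eig: "?L *v z = t *\<^sub>R z" "z \<noteq> 0" and pos: "0 < t" for z t
  proof -
    obtain j where j: "j \<in> {1..CARD('n)}" "lam j = t"
      using eigenvalue_in_ordered_eigenvalues[OF assms(2) eig] by blast
    \<comment> \<open>The first \<open>k\<close> entries are zero, so a positive eigenvalue sits at
      an index \<open>j\<close> with \<open>k + 1 \<le> j\<close>; monotonicity of
      \<open>lam\<close> then gives the gap.\<close>
    then have "k < j"
      using assms(5)[of j] pos by (cases "k < j") auto
    have "lam (k + 1) \<le> lam j"
      using assms(2) unfolding ordered_eigenvalues_def
      by (elim conjE mono_onD) (use j(1) \<open>k < j\<close> in auto)
    then show ?thesis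
      by (simp only: j(2))
  qed
  have bound: "\<bar>x \<bullet> (R i *v x)\<bar> \<le> ?c * (x \<bullet> (?L *v x))" for x
    using abs_inner_matrix_le_of_ker_subset[OF L symR ker assms(6) gap] .
  \<comment> \<open>The two signs of the absolute value: the difference yields the lower Loewner
    bound, the sum the upper one.\<close>
  have form: "0 \<le> x \<bullet> ((?c *\<^sub>R ?L - R i) *v x)" "0 \<le> x \<bullet> ((?c *\<^sub>R ?L + R i) *v x)" for x
    using bound[of x]
    by (simp_all only: matrix_vector_mult_diff_rdistrib matrix_vector_mult_add_rdistrib
        scaleR_matrix_vector_assoc[symmetric] inner_add_right inner_diff_right inner_scaleR_right)
  have "psd (?c *\<^sub>R ?L - R i)" "psd (?c *\<^sub>R ?L + R i)"
    unfolding psd_def using form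
    by (simp_all add: transpose_diff transpose_add transpose_scalar symL symR)
  moreover have "LH i - (1 - ?c) *\<^sub>R ?L = ?c *\<^sub>R ?L - R i"
    and "(1 + ?c) *\<^sub>R ?L - LH i = ?c *\<^sub>R ?L + R i"
    unfolding Ri scaleR_add_left scaleR_diff_left by simp_all
  ultimately show ?thesis
    by (simp only: loewner_le_def)
qed

end
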